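(* Let $L$ be an atomistic lattice, and let $C(L)=A(L)\cup\{0,1\}$ with the order inherited from $L$. Then a binary operation $T$ on $C(L)$ is a t-norm on $C(L)$ if and only if there exists a set $\alpha\subseteq A(L)$ such that $T=T_\alpha$, where $$T_\alpha(x,y)=\begin{cases} x\wedge y, & \text{if } x=1 \text{ or } y=1,\\ x, & \text{if } x=y\in\alpha,\\ 0, & \text{otherwise}.\end{cases}$$
   Context: A lattice $L$ with bottom $0$ and top $1$ is atomistic if every element of $L$ is the join of some set of atoms. An atom is an element covering $0$; $A(L)$ denotes the set of atoms of $L$. $C(L)=A(L)\cup\{0,1\}$ is regarded as a bounded poset with the order inherited from $L$ (it need not be a sublattice of $L$). A t-norm on a bounded poset $P$ with top $1$ is a binary operation $T:P\times P\to P$ that is monotone in each argument, commutative, associative, and has $1$ as neutral element ($T(x,1)=x$ for all $x$). *)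

theory Defs
  imports "HOL-Library.Lub_Glb" "HOL-Library.FuncSet"
begin

text \<open>The lattice \<open>L\<close> is a type of class \<^class>\<open>bounded_lattice\<close>, with \<open>0 = bot\<close> and \<open>1 = top\<close>;
  no completeness is assumed, so joins of arbitrary sets are expressed by \<^const>\<open>isLub\<close>.\<close>

definition covers :: "'a::order \<Rightarrow> 'a \<Rightarrow> bool" where
  "covers y x \<longleftrightarrow> x < y \<and> \<not> (\<exists>z. x < z \<and> z < y)"

definition atoms :: "'a::order_bot set" where
  "atoms = {a. covers a bot}"

definition atomistic :: "'a::bounded_lattice itself \<Rightarrow> bool" where
  "atomistic _ \<longleftrightarrow> (\<forall>x::'a. \<exists>S\<subseteq>atoms. isLub UNIV S x)"

definition C :: "'a::bounded_lattice set" where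
  "C = atoms \<union> {bot, top}"

text \<open>The poset is a subset \<open>P\<close> of an ordered type with the inherited order, and \<open>u\<close> is its top
  element. Only the values of \<open>T\<close> on \<open>P\<close> matter.\<close>

definition t_norm_on :: "'a::order set \<Rightarrow> 'a \<Rightarrow> ('a \<Rightarrow> 'a \<Rightarrow> 'a) \<Rightarrow> bool" where
  "t_norm_on P u T \<longleftrightarrow>
     T \<in> P \<rightarrow> P \<rightarrow> P \<and>
     (\<forall>x\<in>P. mono_on P (\<lambda>y. T x y)) \<and>
     (\<forall>y\<in>P. mono_on P (\<lambda>x. T x y)) \<and>
     (\<forall>x\<in>P. \<forall>y\<in>P. T x y = T y x) \<and>
     (\<forall>x\<in>P. \<forall>y\<in>P. \<forall>z\<in>P. T (T x y) z = T x (T y z)) \<and>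
     (\<forall>x\<in>P. T x u = x)"

definition T_of :: "'a::bounded_lattice set \<Rightarrow> 'a \<Rightarrow> 'a \<Rightarrow> 'a" where
  "T_of \<alpha> x y =
     (if x = top \<or> y = top then inf x y
      else if x = y \<and> x \<in> \<alpha> then x
      else bot)"

end

theory Submission
  imports Defs
begin

text \<open>The order on \<open>C\<close> is flat: distinct comparable elements involve
  \<open>bot\<close> or \<open>top\<close> (\<open>C_le_cases\<close>). Monotonicity and neutrality
  of \<open>top\<close> force T x y to lie below both x and y (\<open>t_norm_on_le\<close>). Hence
  for distinct atoms the value is \<open>bot\<close>, and for an atom a the value T a a is a or
  \<open>bot\<close>. The only freedom left is which atoms are idempotent, and these form \<alpha>
  (\<open>t_norm_on_C_eq_T_of\<close>). Conversely, every choice of \<alpha> gives a t-norm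
  (\<open>t_norm_on_T_of\<close>): flatness leaves almost nothing to check for monotonicity, and a
  product of elements other than \<open>top\<close> is \<open>bot\<close> unless all factors are the
  same member of \<alpha>.\<close>

lemma bot_notin_atoms: "bot \<notin> atoms"
  by (simp add: atoms_def covers_def)

lemma le_atom_cases:
  assumes "a \<in> atoms" and "x \<le> a"
  shows "x = bot \<or> x = a"
  using assms by (metis atoms_def bot.not_eq_extremum covers_def mem_Collect_eq order_le_less)

lemma inf_distinct_atoms:
  fixes a b :: "'a::bounded_lattice"
  assumes "a \<in> atoms" and "b \<in> atoms" and "a \<noteq> b"
  shows "inf a b = bot"
  by (metis assms bot_notin_atoms inf_le1 inf_le2 le_atom_cases)

lemma C_le_cases:
  assumes "x \<in> C" and "y \<in> C" and "x \<le> y"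
  shows "x = bot \<or> x = y \<or> y = top"
  using assms le_atom_cases[of y x] by (auto simp: C_def bot_unique)

lemma T_of_top [simp]: "T_of \<alpha> x top = x" "T_of \<alpha> top x = x"
  by (simp_all add: T_of_def)

lemma T_of_bot [simp]: "T_of \<alpha> x bot = bot" "T_of \<alpha> bot x = bot"
  by (auto simp: T_of_def)

lemma T_of_commute: "T_of \<alpha> x y = T_of \<alpha> y x"
  by (auto simp: T_of_def inf_commute)

lemma T_of_le: "T_of \<alpha> x y \<le> x"
  by (auto simp: T_of_def)

lemma T_of_in_C: "x \<in> C \<Longrightarrow> y \<in> C \<Longrightarrow> T_of \<alpha> x y \<in> C"
  by (auto simp: T_of_def C_def)

text \<open>By flatness, y = \<open>bot\<close> makes the left side \<open>bot\<close>, y = z is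
  trivial, and z = \<open>top\<close> makes the right side x, where \<open>T_of_le\<close>
  applies.\<close>

lemma T_of_mono:
  assumes "y \<in> C" and "z \<in> C" and "y \<le> z"
  shows "T_of \<alpha> x y \<le> T_of \<alpha> x z"
  using C_le_cases[OF assms] by (auto simp: T_of_le)

text \<open>Without a factor \<open>top\<close>, both bracketings give x if x = y = z is in
  \<alpha>, and \<open>bot\<close> otherwise.\<close>

lemma T_of_assoc:
  fixes x y z :: "'a::bounded_lattice"
  shows "T_of \<alpha> (T_of \<alpha> x y) z = T_of \<alpha> x (T_of \<alpha> y z)"
proof (cases "x = top \<or> y = top \<or> z = top")
  case True
  then show ?thesis by auto
next
  case False
  \<comment> \<open>An inner product that collapses to \<open>bot\<close> must not act as the
    neutral element in the outer one. If the two bounds coincided, every element would be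
    \<open>top\<close>.\<close>
  then have "(bot :: 'a) \<noteq> top" by (metis bot_least top_unique)
  with False show ?thesis by (auto simp: T_of_def)
qed

lemma t_norm_on_T_of: "t_norm_on C top (T_of \<alpha>)"
proof -
  have "T_of \<alpha> x z \<le> T_of \<alpha> y z"
    if "x \<in> C" "y \<in> C" "x \<le> y" for x y z
    using T_of_mono[OF that] by (simp add: T_of_commute[of _ _ z])
  then show ?thesis
    unfolding t_norm_on_def mono_on_def Pi_iff
    by (intro conjI ballI allI impI)
      (simp_all add: T_of_in_C T_of_mono T_of_assoc, rule T_of_commute)
qed

lemma t_norm_on_commute: "t_norm_on P u T \<Longrightarrow> x \<in> P \<Longrightarrow> y \<in> P \<Longrightarrow> T x y = T y x"
  unfolding t_norm_on_def by blast

lemma t_norm_on_neutral: "t_norm_on P u T \<Longrightarrow> x \<in> P \<Longrightarrow> T x u = x"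
  unfolding t_norm_on_def by blast

text \<open>The axioms evaluate the operation only at points of P. Closure puts the inner value of a
  nested product back in P, so that \<open>eq\<close> also applies to the outer product.\<close>

lemma t_norm_on_cong:
  assumes eq: "\<And>x y. x \<in> P \<Longrightarrow> y \<in> P \<Longrightarrow> T x y = T' x y"
    and u: "u \<in> P" and T': "t_norm_on P u T'"
  shows "t_norm_on P u T"
proof -
  have closed: "T' x y \<in> P" if "x \<in> P" "y \<in> P" for x y
    using T' that unfolding t_norm_on_def by blast
  have assoc: "T' (T' x y) z = T' x (T' y z)" if "x \<in> P" "y \<in> P" "z \<in> P" for x y z
    using T' that unfolding t_norm_on_def by blast
  have mono: "mono_on P (\<lambda>y. T' x y)" "mono_on P (\<lambda>y. T' y x)" if "x \<in> P" for x
    using T' that unfolding t_norm_on_def by blast+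
  show ?thesis
    unfolding t_norm_on_def
  proof (intro conjI ballI)
    show "T \<in> P \<rightarrow> P \<rightarrow> P" using closed by (simp add: Pi_iff eq)
    show "mono_on P (\<lambda>y. T x y)" "mono_on P (\<lambda>y. T y x)" if "x \<in> P" for x
      using mono[OF that] that by (auto simp: mono_on_def eq)
    show "T x y = T y x" if "x \<in> P" "y \<in> P" for x y
      using t_norm_on_commute[OF T' that] that by (simp add: eq)
    show "T (T x y) z = T x (T y z)" if "x \<in> P" "y \<in> P" "z \<in> P" for x y z
      using assoc[OF that] that by (simp add: eq closed)
    show "T x u = x" if "x \<in> P" for x
      using t_norm_on_neutral[OF T' that] u that by (simp add: eq)
  qed
qed

text \<open>Raising the second argument to u gives T x y \<le> T x u = x; commutativity gives the
  other bound.\<close>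

lemma t_norm_on_le:
  assumes T: "t_norm_on P u T" and u: "u \<in> P" "\<And>z. z \<in> P \<Longrightarrow> z \<le> u"
    and x: "x \<in> P" and y: "y \<in> P"
  shows "T x y \<le> x" and "T x y \<le> y"
proof -
  have le: "T v w \<le> v" if v: "v \<in> P" and w: "w \<in> P" for v w
  proof -
    have "mono_on P (\<lambda>y. T v y)" using T v unfolding t_norm_on_def by blast
    then have "T v w \<le> T v u" using w u(1) u(2)[OF w] by (rule mono_onD)
    then show ?thesis by (simp only: t_norm_on_neutral[OF T v])
  qed
  show "T x y \<le> x" using le[OF x y] .
  show "T x y \<le> y" using le[OF y x] by (simp only: t_norm_on_commute[OF T x y])
qed

lemma t_norm_on_C_eq_T_of:
  fixes T :: "'a::bounded_lattice \<Rightarrow> 'a \<Rightarrow> 'a"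
  assumes T: "t_norm_on C top T" and x: "x \<in> C" and y: "y \<in> C"
  shows "T x y = T_of {a \<in> atoms. T a a = a} x y"
proof -
  have topC: "top \<in> C" by (simp add: C_def)
  have le: "T x y \<le> x" "T x y \<le> y"
    using t_norm_on_le[OF T topC _ x y] by simp_all
  \<comment> \<open>In the two-element lattice \<open>top\<close> is itself an atom, so the case of
    two atoms excludes it explicitly.\<close>
  consider "y = top" | "x = top" | "x = bot \<or> y = bot"
    | "x \<in> atoms" "y \<in> atoms" "x \<noteq> top" "y \<noteq> top"
    using x y by (auto simp: C_def)
  then show ?thesis
  proof cases
    case 1
    then show ?thesis using t_norm_on_neutral[OF T x] by simp
  next
    case 2
    have "T top y = T y top" by (rule t_norm_on_commute[OF T topC y])
    also have "\<dots> = y" by (rule t_norm_on_neutral[OF T y])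
    finally show ?thesis using 2 by simp
  next
    case 3
    then show ?thesis using le by (auto simp: bot_unique)
  next
    case 4
    show ?thesis
    proof (cases "x = y")
      case True
      \<comment> \<open>Below the atom x there are only \<open>bot\<close> and x; which one T x x
        equals is exactly what membership in the set of idempotent atoms records.\<close>
      then show ?thesis using 4 le le_atom_cases[of x "T x y"] by (auto simp: T_of_def)
    next
      case False
      have "T x y \<le> inf x y" using le by simp
      then show ?thesis using 4 False inf_distinct_atoms[of x y] by (simp add: T_of_def bot_unique)
    qed
  qed
qed

theorem theorem3p1:
  fixes T :: "'a::bounded_lattice \<Rightarrow> 'a \<Rightarrow> 'a"
  assumes "atomistic TYPE('a)"
  shows "t_norm_on C top T \<longleftrightarrow>
    (\<exists>\<alpha>\<subseteq>atoms. \<forall>x\<in>C. \<forall>y\<in>C. T x y = T_of \<alpha> x y)"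
proof
  assume "t_norm_on C top T"
  then have "\<forall>x\<in>C. \<forall>y\<in>C. T x y = T_of {a \<in> atoms. T a a = a} x y"
    by (blast intro: t_norm_on_C_eq_T_of)
  then show "\<exists>\<alpha>\<subseteq>atoms. \<forall>x\<in>C. \<forall>y\<in>C. T x y = T_of \<alpha> x y"
    by (intro exI[of _ "{a \<in> atoms. T a a = a}"]) auto
next
  assume "\<exists>\<alpha>\<subseteq>atoms. \<forall>x\<in>C. \<forall>y\<in>C. T x y = T_of \<alpha> x y"
  then obtain \<alpha> where "\<And>x y. x \<in> C \<Longrightarrow> y \<in> C \<Longrightarrow> T x y = T_of \<alpha> x y" by blast
  then show "t_norm_on C top T"
    by (rule t_norm_on_cong[OF _ _ t_norm_on_T_of]) (auto simp: C_def)
qed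

end
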